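(* Let $n\geq 25$, let $G\in\{A_n,S_n\}$, let $H$ be a core-free maximal subgroup of $G$ that is primitive on $[n]$, and let $K$ be a maximal subgroup of $G$ which is not primitive on $[n]$. Then $K$ is not a fixer of $G$ (with respect to the action of $G$ on $[G:H]$).
   Context: $[n]=\{1,\dots,n\}$. For a finite group $G$ acting transitively with point stabiliser $H$ (equivalently on the cosets $[G:H]$), a subgroup $K\leq G$ is a fixer if every element of $K$ has a fixed point, i.e. is $G$-conjugate to an element of $H$. *)

theory Defs
  imports
    "HOL-Algebra.Sym_Groups"
    "HOL-Algebra.Group_Action"
    "HOL-Algebra.Left_Coset"
    "HOL-Library.Disjoint_Sets"
begin

definition maximal_subgroup :: "'a set \<Rightarrow> ('a, 'b) monoid_scheme \<Rightarrow> bool"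
  where "maximal_subgroup H G \<longleftrightarrow>
    subgroup H G \<and> H \<noteq> carrier G \<and>
    (\<forall>L. subgroup L G \<and> H \<subseteq> L \<longrightarrow> L = H \<or> L = carrier G)"

definition normal_core :: "('a, 'b) monoid_scheme \<Rightarrow> 'a set \<Rightarrow> 'a set"
  where "normal_core G H = (\<Inter>g \<in> carrier G. g <#\<^bsub>G\<^esub> H #>\<^bsub>G\<^esub> inv\<^bsub>G\<^esub> g)"

definition core_free :: "('a, 'b) monoid_scheme \<Rightarrow> 'a set \<Rightarrow> bool"
  where "core_free G H \<longleftrightarrow> normal_core G H = {\<one>\<^bsub>G\<^esub>}"

text \<open>A transitive action is primitive if the only invariant partitions are the one with a
  single block and the one into singletons.\<close>

locale primitive_action = transitive_action +
  assumes trivial_partition: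
    "\<lbrakk> partition_on E P; \<And>g B. \<lbrakk> g \<in> carrier G; B \<in> P \<rbrakk> \<Longrightarrow> \<phi> g ` B \<in> P \<rbrakk>
      \<Longrightarrow> P = {E} \<or> P = (\<lambda>x. {x}) ` E"

text \<open>The restriction makes \<open>perm_action E p\<close> extensional on \<open>E\<close>, as \<^const>\<open>BijGroup\<close> requires.\<close>

definition perm_action :: "'a set \<Rightarrow> ('a \<Rightarrow> 'a) \<Rightarrow> 'a \<Rightarrow> 'a"
  where "perm_action E p = restrict p E"

definition primitive_on :: "nat \<Rightarrow> (nat \<Rightarrow> nat) set \<Rightarrow> bool"
  where "primitive_on n H \<longleftrightarrow>
    primitive_action ((sym_group n)\<lparr>carrier := H\<rparr>) {1..n} (perm_action {1..n})"

text \<open>\<open>G\<close> acts on the left cosets of \<open>H\<close> by left multiplication; via inversion this is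
  the action on the right cosets by right multiplication.\<close>

definition coset_action :: "('a, 'b) monoid_scheme \<Rightarrow> 'a set \<Rightarrow> 'a \<Rightarrow> 'a set \<Rightarrow> 'a set"
  where "coset_action G H g = (\<lambda>C \<in> lcosets\<^bsub>G\<^esub> H. g <#\<^bsub>G\<^esub> C)"

definition fixer ::
    "('a, 'b) monoid_scheme \<Rightarrow> 'c set \<Rightarrow> ('a \<Rightarrow> 'c \<Rightarrow> 'c) \<Rightarrow> 'a set \<Rightarrow> bool"
  where "fixer G E \<phi> K \<longleftrightarrow> subgroup K G \<and> (\<forall>k \<in> K. invariants E \<phi> k \<noteq> {})"

lemma perm_action_group_action:
  assumes "subgroup H (sym_group n)"
  shows "group_action ((sym_group n)\<lparr>carrier := H\<rparr>) {1..n} (perm_action {1..n})"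
proof -
  have P: "p permutes {1..n}" if "p \<in> H" for p
    using subgroup.subset[OF assms] that by (auto simp: sym_group_def)
  have B: "perm_action {1..n} p \<in> Bij {1..n}" if "p \<in> H" for p
    using permutes_imp_bij[OF P[OF that]]
    by (simp add: Bij_def perm_action_def bij_betw_restrict_eq)
  have "perm_action {1..n} (p \<circ> q) = compose {1..n} (perm_action {1..n} p) (perm_action {1..n} q)"
    if "q \<in> H" for p q
    using permutes_in_image[OF P[OF that]]
    by (auto simp: fun_eq_iff perm_action_def compose_def restrict_def)
  then have "perm_action {1..n} \<in> hom ((sym_group n)\<lparr>carrier := H\<rparr>) (BijGroup {1..n})"
    using B by (auto simp: hom_def BijGroup_def sym_group_def)
  then show ?thesis
    using subgroup.subgroup_is_group[OF assms sym_group_is_group]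
    by (simp add: group_action_def group_hom_def group_hom_axioms_def group_BijGroup)
qed

lemma coset_action_transitive:
  assumes "group G" "subgroup H G"
  shows "transitive_action G (lcosets\<^bsub>G\<^esub> H) (coset_action G H)"
proof -
  interpret group G by fact
  interpret subgroup H G by fact
  let ?E = "lcosets\<^bsub>G\<^esub> H"
  have sub: "C \<subseteq> carrier G" if "C \<in> ?E" for C
    using lcosets_carrier[OF assms(1) that] .
  have closed: "g <#\<^bsub>G\<^esub> C \<in> ?E" if "g \<in> carrier G" "C \<in> ?E" for g C
    using that by (auto simp: LCOSETS_def lcos_m_assoc[OF subset])
  have assoc: "g <#\<^bsub>G\<^esub> (h <#\<^bsub>G\<^esub> C) = (g \<otimes>\<^bsub>G\<^esub> h) <#\<^bsub>G\<^esub> C"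
    if "g \<in> carrier G" "h \<in> carrier G" "C \<in> ?E" for g h C
    using lcos_m_assoc[OF sub[OF that(3)] that(1,2)] .
  have inv1: "inv\<^bsub>G\<^esub> g <#\<^bsub>G\<^esub> (g <#\<^bsub>G\<^esub> C) = C" "g <#\<^bsub>G\<^esub> (inv\<^bsub>G\<^esub> g <#\<^bsub>G\<^esub> C) = C"
    if "g \<in> carrier G" "C \<in> ?E" for g C
    using that sub by (simp_all add: assoc lcos_mult_one)
  have bij: "bij_betw (\<lambda>C. g <#\<^bsub>G\<^esub> C) ?E ?E" if "g \<in> carrier G" for g
    by (rule bij_betw_byWitness[where f' = "\<lambda>C. inv\<^bsub>G\<^esub> g <#\<^bsub>G\<^esub> C"])
      (use that inv1 closed in auto)
  have B: "coset_action G H g \<in> Bij ?E" if "g \<in> carrier G" for g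
    using bij[OF that] by (simp add: Bij_def coset_action_def bij_betw_restrict_eq)
  have "coset_action G H (g \<otimes>\<^bsub>G\<^esub> h) = compose ?E (coset_action G H g) (coset_action G H h)"
    if "g \<in> carrier G" "h \<in> carrier G" for g h
    using that closed assoc by (auto simp: fun_eq_iff coset_action_def compose_def restrict_def)
  then have "coset_action G H \<in> hom G (BijGroup ?E)"
    using B by (auto simp: hom_def BijGroup_def)
  then have act: "group_action G ?E (coset_action G H)"
    using assms by (simp add: group_action_def group_hom_def group_hom_axioms_def group_BijGroup)
  have "\<exists>g\<in>carrier G. coset_action G H g C = D" if "C \<in> ?E" "D \<in> ?E" for C D
  proof -
    obtain a b where ab: "a \<in> carrier G" "C = a <#\<^bsub>G\<^esub> H" "b \<in> carrier G" "D = b <#\<^bsub>G\<^esub> H"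
      using \<open>C \<in> ?E\<close> \<open>D \<in> ?E\<close> unfolding LCOSETS_def by blast
    have "(b \<otimes>\<^bsub>G\<^esub> inv\<^bsub>G\<^esub> a) <#\<^bsub>G\<^esub> C = D"
      using ab by (simp add: lcos_m_assoc[OF subset] m_assoc)
    with that ab show ?thesis
      by (intro bexI[of _ "b \<otimes>\<^bsub>G\<^esub> inv\<^bsub>G\<^esub> a"]) (auto simp: coset_action_def)
  qed
  with act show ?thesis
    by (simp add: transitive_action_def transitive_action_axioms_def)
qed

lemma fixer_coset_action_iff:
  assumes "group G" "subgroup H G"
  shows "fixer G (lcosets\<^bsub>G\<^esub> H) (coset_action G H) K \<longleftrightarrow>
    subgroup K G \<and> (\<forall>k\<in>K. \<exists>g\<in>carrier G. inv\<^bsub>G\<^esub> g \<otimes>\<^bsub>G\<^esub> k \<otimes>\<^bsub>G\<^esub> g \<in> H)"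
proof -
  interpret group G by fact
  interpret subgroup H G by fact
  have *: "k <#\<^bsub>G\<^esub> (g <#\<^bsub>G\<^esub> H) = g <#\<^bsub>G\<^esub> H \<longleftrightarrow> inv\<^bsub>G\<^esub> g \<otimes>\<^bsub>G\<^esub> k \<otimes>\<^bsub>G\<^esub> g \<in> H"
    if kg: "k \<in> carrier G" "g \<in> carrier G" for k g
  proof -
    have "k <#\<^bsub>G\<^esub> (g <#\<^bsub>G\<^esub> H) = (k \<otimes>\<^bsub>G\<^esub> g) <#\<^bsub>G\<^esub> H"
      using kg by (simp add: lcos_m_assoc[OF subset])
    moreover have kgc: "k \<otimes>\<^bsub>G\<^esub> g \<in> carrier G"
      using kg by (rule monoid.m_closed[OF is_monoid])
    moreover have "(k \<otimes>\<^bsub>G\<^esub> g) <#\<^bsub>G\<^esub> H = g <#\<^bsub>G\<^esub> H \<longleftrightarrow> k \<otimes>\<^bsub>G\<^esub> g \<in> g <#\<^bsub>G\<^esub> H"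
      using l_repr_independence[OF _ kg(2) assms(2)] lcos_self[OF kgc assms(2)] by blast
    moreover have "k \<otimes>\<^bsub>G\<^esub> g \<in> g <#\<^bsub>G\<^esub> H \<longleftrightarrow> inv\<^bsub>G\<^esub> g \<otimes>\<^bsub>G\<^esub> (k \<otimes>\<^bsub>G\<^esub> g) \<in> H"
      using lcos_module_imp[OF assms(1) kg(2)] lcos_module_rev[OF assms(1) kg(2) kgc] by blast
    ultimately show ?thesis
      using kg by (simp add: m_assoc)
  qed
  have "invariants (lcosets\<^bsub>G\<^esub> H) (coset_action G H) k \<noteq> {} \<longleftrightarrow>
      (\<exists>g\<in>carrier G. inv\<^bsub>G\<^esub> g \<otimes>\<^bsub>G\<^esub> k \<otimes>\<^bsub>G\<^esub> g \<in> H)" if "k \<in> carrier G" for k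
  proof -
    have "invariants (lcosets\<^bsub>G\<^esub> H) (coset_action G H) k \<noteq> {} \<longleftrightarrow>
        (\<exists>C \<in> lcosets\<^bsub>G\<^esub> H. k <#\<^bsub>G\<^esub> C = C)"
      unfolding invariants_def coset_action_def by auto
    also have "\<dots> \<longleftrightarrow> (\<exists>g\<in>carrier G. k <#\<^bsub>G\<^esub> (g <#\<^bsub>G\<^esub> H) = g <#\<^bsub>G\<^esub> H)"
      unfolding LCOSETS_def by blast
    also have "\<dots> \<longleftrightarrow> (\<exists>g\<in>carrier G. inv\<^bsub>G\<^esub> g \<otimes>\<^bsub>G\<^esub> k \<otimes>\<^bsub>G\<^esub> g \<in> H)"
      by (rule bex_cong[OF refl]) (rule *[OF that])
    finally show ?thesis .
  qed
  then show ?thesis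
    unfolding fixer_def using subgroup.mem_carrier[of K G] by meson
qed

end

theory Submission
  imports Defs
begin

text \<open>
  A group \<open>K\<close> that is not primitive preserves a nontrivial equivalence relation: its orbits
  yield one with two classes if it is intransitive, and otherwise all classes have the same size.
  By maximality \<open>K\<close> consists of all elements of \<open>G\<close> preserving the relation.

  If some class has at least three elements, then \<open>K\<close> contains a 3-cycle,
  and so does \<open>H\<close> after conjugation. If all classes are pairs, then \<open>K\<close> contains the double
  transposition of two pairs and an even permutation \<open>d\<close> that fixes one pair
  \<open>{\<alpha>, \<beta>}\<close> pointwise and has only cycles of length \<open>n/2 - 1\<close> elsewhere.
  A conjugate of \<open>d\<close> in \<open>H\<close> makes all nontrivial orbits of a point stabiliser of
  \<open>H\<close> so long that Neumann's separation lemma provides two double transpositions in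
  \<open>H\<close> whose supports share exactly one point; their commutator is a 3-cycle. In both cases
  Jordan's theorem shows that \<open>H\<close> contains the alternating group and is not core-free.
\<close>

section \<open>Primitive permutation groups\<close>

definition three_cycle :: "'a \<Rightarrow> 'a \<Rightarrow> 'a \<Rightarrow> 'a \<Rightarrow> 'a"
  where "three_cycle a b c = transpose a b \<circ> transpose b c"

lemma three_cycle_simps [simp]:
  assumes "a \<noteq> b" "b \<noteq> c" "a \<noteq> c"
  shows "three_cycle a b c a = b" "three_cycle a b c b = c" "three_cycle a b c c = a"
  using assms by (auto simp: three_cycle_def transpose_def)

lemma three_cycle_other [simp]:
  "x \<noteq> a \<Longrightarrow> x \<noteq> b \<Longrightarrow> x \<noteq> c \<Longrightarrow> three_cycle a b c x = x"
  by (auto simp: three_cycle_def transpose_def)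

lemma three_cycle_rotate:
  assumes "a \<noteq> b" "b \<noteq> c" "a \<noteq> c"
  shows "three_cycle b c a = three_cycle a b c"
  using assms by (auto simp: three_cycle_def transpose_def fun_eq_iff)

lemma inv_three_cycle:
  assumes "a \<noteq> b" "b \<noteq> c" "a \<noteq> c"
  shows "inv' (three_cycle a b c) = three_cycle a c b"
  by (rule inv_unique_comp)
    (use assms in \<open>auto simp: three_cycle_def transpose_def fun_eq_iff\<close>)

lemma conj_transpose:
  assumes "bij h"
  shows "h \<circ> transpose a b \<circ> inv' h = transpose (h a) (h b)"
proof
  fix x
  obtain y where "x = h y"
    using assms by (metis bij_pointE)
  with assms show "(h \<circ> transpose a b \<circ> inv' h) x = transpose (h a) (h b) x"
    by (simp add: inv_f_f bij_is_inj transpose_def) (auto dest: bij_is_inj injD)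
qed

lemma conj_comp:
  assumes "bij h"
  shows "h \<circ> (f \<circ> g) \<circ> inv' h = (h \<circ> f \<circ> inv' h) \<circ> (h \<circ> g \<circ> inv' h)"
  using assms by (simp add: fun_eq_iff inv_f_f bij_is_inj)

lemma conj_three_cycle:
  assumes "bij h"
  shows "h \<circ> three_cycle a b c \<circ> inv' h = three_cycle (h a) (h b) (h c)"
  using assms by (simp add: three_cycle_def conj_comp conj_transpose)

lemma three_cycle_permutes:
  assumes "a \<in> A" "b \<in> A" "c \<in> A"
  shows "three_cycle a b c permutes A"
  unfolding three_cycle_def using assms by (intro permutes_compose permutes_swap_id)

lemma evenperm_transpose_comp:
  assumes "a \<noteq> b" "c \<noteq> d"
  shows "evenperm (transpose a b \<circ> transpose c d)"
  using assms by (simp add: evenperm_comp permutation_swap_id evenperm_swap)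

section \<open>Groups of permutations of a finite set\<close>

locale perm_group =
  fixes E :: "'a set" and H :: "('a \<Rightarrow> 'a) set"
  assumes fin: "finite E"
    and perm: "h \<in> H \<Longrightarrow> h permutes E"
    and id_mem: "id \<in> H"
    and comp_mem: "g \<in> H \<Longrightarrow> h \<in> H \<Longrightarrow> g \<circ> h \<in> H"
    and inv_mem: "h \<in> H \<Longrightarrow> inv' h \<in> H"
begin

lemma bij_mem: "h \<in> H \<Longrightarrow> bij h"
  using perm permutes_bij by blast

lemma inj_mem: "h \<in> H \<Longrightarrow> h x = h y \<longleftrightarrow> x = y"
  using bij_mem by (simp add: bij_is_inj inj_eq)

lemma in_E_iff [simp]: "h \<in> H \<Longrightarrow> h x \<in> E \<longleftrightarrow> x \<in> E"
  using perm permutes_in_image by metis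

lemma inv_apply [simp]: "h \<in> H \<Longrightarrow> inv' h (h x) = x" "h \<in> H \<Longrightarrow> h (inv' h x) = x"
  using bij_mem by (simp_all add: bij_is_inj inv_f_f bij_is_surj surj_f_inv_f)

lemma inv_eq_iff: "h \<in> H \<Longrightarrow> inv' h x = y \<longleftrightarrow> x = h y"
  by (metis inv_apply)

lemma conj_mem: "g \<in> H \<Longrightarrow> h \<in> H \<Longrightarrow> h \<circ> g \<circ> inv' h \<in> H"
  by (intro comp_mem inv_mem)

lemma funpow_mem: "h \<in> H \<Longrightarrow> h ^^ k \<in> H"
  by (induction k) (auto intro: comp_mem id_mem)

lemma finite_group: "finite H"
  using finite_permutations[OF fin] perm by (rule_tac finite_subset[of H]) auto

lemma conj_three_cycle_mem:
  "three_cycle a b c \<in> H \<Longrightarrow> h \<in> H \<Longrightarrow> three_cycle (h a) (h b) (h c) \<in> H"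
  using conj_mem[of "three_cycle a b c" h] conj_three_cycle[OF bij_mem] by metis

lemma three_cycle_mem_rotate:
  assumes "a \<noteq> b" "b \<noteq> c" "a \<noteq> c"
  shows "three_cycle b c a \<in> H \<longleftrightarrow> three_cycle a b c \<in> H"
  using three_cycle_rotate[OF assms] by simp

lemma three_cycle_mem_swap:
  assumes "a \<noteq> b" "b \<noteq> c" "a \<noteq> c" "three_cycle a c b \<in> H"
  shows "three_cycle a b c \<in> H"
  using inv_mem[OF assms(4)] inv_three_cycle[of a c b] assms by metis

lemma three_cycle_subset:
  assumes "three_cycle a b c \<in> H" "a \<noteq> b" "b \<noteq> c" "a \<noteq> c"
  shows "a \<in> E" "b \<in> E" "c \<in> E"
  using permutes_not_in[OF perm[OF assms(1)]] three_cycle_simps[OF assms(2-4)] assms(2-4)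
  by metis+

end

section \<open>Primitivity through invariant equivalence relations, and Jordan's theorem\<close>

locale primitive_perm_group = perm_group +
  assumes trans: "x \<in> E \<Longrightarrow> y \<in> E \<Longrightarrow> \<exists>h\<in>H. h x = y"
    and primitive: "equiv E r \<Longrightarrow> (\<And>h x y. h \<in> H \<Longrightarrow> (x, y) \<in> r \<Longrightarrow> (h x, h y) \<in> r)
      \<Longrightarrow> r = E \<times> E \<or> r = Id_on E"

context primitive_perm_group
begin

text \<open>Being equal or consecutive in a 3-cycle of \<open>H\<close> is an
  \<open>H\<close>-invariant equivalence relation on \<open>E\<close>. It relates \<open>a\<close>
  to \<open>b\<close>, so by primitivity it relates all points.\<close>

lemma three_cycle_through_two_points:
  assumes "three_cycle a b c \<in> H" and abc: "a \<noteq> b" "b \<noteq> c" "a \<noteq> c"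
    and "x \<in> E" "y \<in> E" "x \<noteq> y"
  obtains z where "z \<noteq> x" "z \<noteq> y" "three_cycle x y z \<in> H"
proof -
  define r where "r = {(x, y). x \<in> E \<and> y \<in> E \<and>
    (x = y \<or> (\<exists>z. z \<noteq> x \<and> z \<noteq> y \<and> three_cycle x y z \<in> H))}"
  \<comment> \<open>Transitivity. If \<open>u = x\<close>, the inverse of the second cycle already
    sends \<open>x\<close> to \<open>w\<close>. Otherwise the second cycle fixes \<open>x\<close>
    and sends \<open>y\<close> to \<open>w\<close>, so conjugating the first cycle by it gives one
    that sends \<open>x\<close> to \<open>w\<close>.\<close>
  have step: "\<exists>z. z \<noteq> x \<and> z \<noteq> w \<and> three_cycle x w z \<in> H"
    if xy: "three_cycle x y z \<in> H" "x \<noteq> y" "y \<noteq> z" "x \<noteq> z"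
      and yw: "three_cycle y w u \<in> H" "y \<noteq> w" "w \<noteq> u" "y \<noteq> u" and "x \<noteq> w" for x y z w u
  proof (cases "u = x")
    case True
    then have "three_cycle y w x \<in> H" using yw by simp
    then have "three_cycle w x y \<in> H"
      using three_cycle_mem_rotate[of y w x] yw True \<open>x \<noteq> w\<close> by auto
    then have "three_cycle x y w \<in> H"
      using three_cycle_mem_rotate[of w x y] yw True \<open>x \<noteq> w\<close> by auto
    then show ?thesis
      using three_cycle_mem_swap[of x w y] yw True \<open>x \<noteq> w\<close> by auto
  next
    case False
    let ?g = "three_cycle y w u"
    have gx: "?g x = x" and gy: "?g y = w"
      using yw False \<open>x \<noteq> w\<close> xy by auto
    have "three_cycle (?g x) (?g y) (?g z) \<in> H"
      using conj_three_cycle_mem[OF xy(1) yw(1)] .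
    moreover have "?g z \<noteq> ?g x" "?g z \<noteq> ?g y"
      using inj_mem[OF yw(1)] xy by auto
    ultimately show ?thesis using gx gy by metis
  qed
  have "equiv E r"
  proof (rule equivI)
    show "r \<subseteq> E \<times> E" "refl_on E r" by (auto simp: r_def refl_on_def)
    show "sym r"
    proof (rule symI)
      fix x y assume "(x, y) \<in> r"
      then show "(y, x) \<in> r"
        unfolding r_def
        using three_cycle_mem_swap[of y x] three_cycle_mem_rotate[of x y]
        by auto
    qed
    show "trans r"
    proof (rule transI)
      fix x y w assume "(x, y) \<in> r" "(y, w) \<in> r"
      then show "(x, w) \<in> r"
        using step[of x y _ w] unfolding r_def by simp metis
    qed
  qed
  moreover have "(h x, h y) \<in> r" if h: "h \<in> H" and "(x, y) \<in> r" for h x y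
    using that conj_three_cycle_mem[of x y _ h]
    unfolding r_def by (auto simp: inj_mem) (metis inj_mem)
  ultimately have "r = E \<times> E \<or> r = Id_on E"
    by (rule primitive)
  moreover have "(a, b) \<in> r"
    using assms three_cycle_subset[OF assms(1-4)] by (auto simp: r_def)
  ultimately have "r = E \<times> E"
    using abc by auto
  then have "(x, y) \<in> r" using assms by auto
  then show thesis
    using that \<open>x \<noteq> y\<close> by (auto simp: r_def)
qed

text \<open>Jordan's theorem on primitive groups containing a 3-cycle.\<close>

lemma three_cycle_mem:
  assumes "three_cycle a b c \<in> H" and abc: "a \<noteq> b" "b \<noteq> c" "a \<noteq> c"
    and E: "x \<in> E" "y \<in> E" "z \<in> E" and xyz: "x \<noteq> y" "y \<noteq> z" "x \<noteq> z"
  shows "three_cycle x y z \<in> H"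
proof -
  obtain w where w: "w \<noteq> x" "w \<noteq> y" "three_cycle x y w \<in> H"
    using three_cycle_through_two_points[OF assms(1-4) E(1,2) xyz(1)] by metis
  show ?thesis
  proof (cases "w = z")
    case False
    obtain u where u: "u \<noteq> w" "u \<noteq> z" "three_cycle w z u \<in> H"
      using three_cycle_through_two_points[OF assms(1-4) _ E(3) False]
        three_cycle_subset(3)[OF w(3)] w xyz by metis
    \<comment> \<open>If the cycles (x y w) and (w z u) share only \<open>w\<close>, the second
      conjugates the first to (x y z). For \<open>u = x\<close>, conjugating the second by the first
      gives (x z y), the inverse of the goal; for \<open>u = y\<close>, conjugating it by the
      inverse of the first gives (y z x).\<close>
    consider "u = x" | "u = y" | "u \<noteq> x" "u \<noteq> y" by blast
    then show ?thesis
    proof cases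
      case 1
      have "three_cycle (three_cycle x y w w) (three_cycle x y w z) (three_cycle x y w x) \<in> H"
        using conj_three_cycle_mem[OF u(3) w(3)] 1 by simp
      moreover have "three_cycle x y w z = z" using xyz False w by simp
      ultimately have "three_cycle x z y \<in> H" using xyz w by simp
      then show ?thesis using three_cycle_mem_swap xyz by metis
    next
      case 2
      have s: "three_cycle x w y \<in> H"
        using three_cycle_mem_swap[of x w y] w xyz by metis
      have "three_cycle (three_cycle x w y w) (three_cycle x w y z) (three_cycle x w y y) \<in> H"
        using conj_three_cycle_mem[OF u(3) s] 2 by simp
      moreover have "three_cycle x w y z = z" using xyz False w by simp
      ultimately have "three_cycle y z x \<in> H" using xyz w by simp
      then show ?thesis using three_cycle_mem_rotate xyz by metis
    next
      case 3
      have "three_cycle (three_cycle w z u x) (three_cycle w z u y) (three_cycle w z u w) \<in> H"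
        using conj_three_cycle_mem[OF w(3) u(3)] by simp
      moreover have "three_cycle w z u x = x" "three_cycle w z u y = y"
        using xyz False w 3 by simp_all
      ultimately show ?thesis using False u by simp
    qed
  qed (use w in simp)
qed

end

section \<open>Orbit counting and separation\<close>

context perm_group
begin

lemma perm_group_stabilizer: "perm_group E {h \<in> H. h x = x}"
  by unfold_locales (auto simp: fin perm id_mem comp_mem inv_mem inv_eq_iff)

text \<open>The sets of elements sending \<open>y\<close> to the various points of its orbit are the
  cosets of its stabiliser: they partition \<open>H\<close> and have equal size. Only an inequality
  holds in general, since no element sends \<open>y\<close> to a point \<open>z\<close> outside its
  orbit.\<close>

lemma card_transporter_mult_orbit:
  "card {h \<in> H. h y = z} * card ((\<lambda>h. h y) ` H) \<le> card H"
proof (cases "\<exists>h\<in>H. h y = z")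
  case True
  let ?O = "(\<lambda>h. h y) ` H" and ?T = "\<lambda>w. {h \<in> H. h y = w}"
  obtain k where k: "k \<in> H" "k y = z" using True by blast
  have "card (?T w) = card (?T z)" if "w \<in> ?O" for w
  proof -
    obtain l where l: "l \<in> H" "l y = w" using \<open>w \<in> ?O\<close> by blast
    have g: "(l \<circ> inv' k) \<in> H" "(k \<circ> inv' l) \<in> H"
      using k l by (simp_all add: comp_mem inv_mem)
    have e: "inv' k z = y" "inv' l w = y" using k l by (simp_all add: inv_eq_iff)
    have "bij_betw (\<lambda>h. (k \<circ> inv' l) \<circ> h) (?T w) (?T z)"
    proof (rule bij_betw_byWitness[where f' = "\<lambda>h. (l \<circ> inv' k) \<circ> h"])
      show "(\<lambda>h. (k \<circ> inv' l) \<circ> h) ` ?T w \<subseteq> ?T z"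
        using comp_mem[OF g(2)] e k by auto
      show "(\<lambda>h. (l \<circ> inv' k) \<circ> h) ` ?T z \<subseteq> ?T w"
        using comp_mem[OF g(1)] e l by auto
    qed (use k(1) l(1) in \<open>simp_all add: fun_eq_iff\<close>)
    then show ?thesis by (rule bij_betw_same_card)
  qed
  then have "(\<Sum>w\<in>?O. card (?T w)) = (\<Sum>w\<in>?O. card (?T z))"
    by (rule sum.cong[OF refl])
  then have "(\<Sum>w\<in>?O. card (?T w)) = card ?O * card (?T z)"
    by simp
  moreover have "(\<Sum>w\<in>?O. card (?T w)) = card (\<Union>w\<in>?O. ?T w)"
    using finite_group by (intro card_UN_disjoint[symmetric]) auto
  moreover have "(\<Union>w\<in>?O. ?T w) = H" by auto
  ultimately show ?thesis by (simp add: mult.commute)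
next
  case False
  then have "{h \<in> H. h y = z} = {}" by blast
  then show ?thesis by (metis card.empty mult_0 le0)
qed

text \<open>Neumann's separation lemma: a pair \<open>(y, z)\<close> rules out a fraction of the group equal to the
  inverse of the size of the orbit of \<open>y\<close>.\<close>

lemma separation:
  assumes "finite S" "finite T"
    and orbits: "\<And>y. y \<in> S \<Longrightarrow> card S * card T < card ((\<lambda>h. h y) ` H)"
  obtains h where "h \<in> H" "h ` S \<inter> T = {}"
proof (rule ccontr)
  assume "\<not> thesis"
  then have ne: "\<And>h. h \<in> H \<Longrightarrow> h ` S \<inter> T \<noteq> {}" using that by blast
  let ?N = "card S * card T" and ?c = "\<lambda>(y, z). card {h \<in> H. h y = z}"
  \<comment> \<open>If separation fails, every element sends some point of \<open>S\<close> into
    \<open>T\<close>, so the transporters of the pairs cover \<open>H\<close>.\<close>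
  have "H \<subseteq> (\<Union>(y, z)\<in>S \<times> T. {h \<in> H. h y = z})"
    using ne by fastforce
  then have "card H \<le> card (\<Union>(y, z)\<in>S \<times> T. {h \<in> H. h y = z})"
    using finite_group assms(1,2) by (intro card_mono) (auto simp: case_prod_unfold)
  also have "\<dots> \<le> (\<Sum>p\<in>S \<times> T. ?c p)"
    using card_UN_le[of "S \<times> T" "\<lambda>(y, z). {h \<in> H. h y = z}"] assms(1,2)
    by (simp add: case_prod_unfold)
  finally have le: "card H \<le> (\<Sum>p\<in>S \<times> T. ?c p)" .
  \<comment> \<open>The strict bound on the orbits yields the \<open>Suc\<close>: \<open>?N\<close>
    transporters, each of size at most \<open>card H / Suc ?N\<close>, cannot cover the nonempty
    group.\<close>
  have "?c p * Suc ?N \<le> card H" if "p \<in> S \<times> T" for p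
  proof -
    obtain y z where p: "p = (y, z)" "y \<in> S"
      using \<open>p \<in> S \<times> T\<close> by blast
    have "?c p * Suc ?N \<le> ?c p * card ((\<lambda>h. h y) ` H)"
      using orbits[OF p(2)] by (intro mult_left_mono) auto
    then show ?thesis
      using card_transporter_mult_orbit[of y z] p by simp
  qed
  then have "(\<Sum>p\<in>S \<times> T. ?c p * Suc ?N) \<le> (\<Sum>p\<in>S \<times> T. card H)"
    by (rule sum_mono)
  also have "\<dots> = ?N * card H" by (simp add: card_cartesian_product)
  finally have "(\<Sum>p\<in>S \<times> T. ?c p) * Suc ?N \<le> ?N * card H"
    by (simp only: sum_distrib_right)
  moreover have "card H * Suc ?N \<le> (\<Sum>p\<in>S \<times> T. ?c p) * Suc ?N"
    using le by (rule mult_right_mono) simp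
  ultimately have "card H * Suc ?N \<le> card H * ?N"
    by (simp only: mult.commute[of ?N])
  moreover have "card H > 0" using finite_group id_mem card_gt_0_iff by blast
  ultimately show False by simp
qed

end

section \<open>Point stabilisers with long orbits\<close>

context primitive_perm_group
begin

text \<open>Having the same stabiliser is an invariant equivalence relation. If the stabiliser of
  \<alpha> fixed \<beta>, the two stabilisers, being conjugate and finite, would coincide; by
  primitivity all stabilisers would, and \<open>d\<close> would fix every point.\<close>

lemma stabilizer_moves:
  assumes "\<alpha> \<in> E" "\<beta> \<in> E" "\<alpha> \<noteq> \<beta>" "d \<in> H" "d \<alpha> = \<alpha>" "d \<noteq> id"
  obtains h where "h \<in> H" "h \<alpha> = \<alpha>" "h \<beta> \<noteq> \<beta>"
proof (rule ccontr)
  assume "\<not> thesis"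
  let ?S = "\<lambda>x. {h \<in> H. h x = x}"
  have conj: "?S (g x) = (\<lambda>h. g \<circ> h \<circ> inv' g) ` ?S x" if "g \<in> H" for g x
  proof (intro equalityI subsetI)
    fix h assume h: "h \<in> ?S (g x)"
    have "h = g \<circ> (inv' g \<circ> h \<circ> g) \<circ> inv' g"
      using that by (simp add: fun_eq_iff)
    moreover have "inv' g \<circ> h \<circ> g \<in> ?S x"
      using h that by (auto simp: comp_mem inv_mem)
    ultimately show "h \<in> (\<lambda>h. g \<circ> h \<circ> inv' g) ` ?S x" by blast
  qed (use that in \<open>auto simp: comp_mem inv_mem\<close>)
  define r where "r = {(x, y). x \<in> E \<and> y \<in> E \<and> ?S x = ?S y}"
  have "equiv E r"
    by (rule equivI) (auto simp: r_def refl_on_def sym_def trans_def)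
  moreover have "(h x, h y) \<in> r" if "h \<in> H" "(x, y) \<in> r" for h x y
    using that conj[of h x] conj[of h y] by (simp add: r_def)
  ultimately have "r = E \<times> E \<or> r = Id_on E"
    by (rule primitive)
  moreover have "(\<alpha>, \<beta>) \<in> r"
  proof -
    obtain g where g: "g \<in> H" "g \<alpha> = \<beta>" using trans assms(1,2) by blast
    have "card (?S \<beta>) \<le> card (?S \<alpha>)"
      using conj[OF g(1), of \<alpha>] g finite_group card_image_le[of "?S \<alpha>"] by simp
    moreover have "?S \<alpha> \<subseteq> ?S \<beta>" using \<open>\<not> thesis\<close> that by blast
    ultimately have "?S \<alpha> = ?S \<beta>"
      using finite_group by (intro card_seteq) auto
    then show ?thesis using assms by (simp add: r_def)
  qed
  ultimately have "r = E \<times> E" using assms(3) by auto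
  then have "?S \<alpha> = ?S x" if "x \<in> E" for x
    using that assms(1) unfolding r_def by blast
  then have "d x = x" if "x \<in> E" for x
    using that assms(4,5) by blast
  then have "d = id"
    using permutes_not_in[OF perm[OF assms(4)]] by fastforce
  then show False using assms(6) by simp
qed

text \<open>The powers of \<open>d\<close> lie in the stabiliser of \<alpha> and already carry any
  point outside \<alpha>, \<beta> to more than \<open>m\<close> points. The point \<beta>, which
  \<open>d\<close> fixes, is first moved away by \<open>stabilizer_moves\<close>.\<close>

lemma stabilizer_orbit_large:
  assumes "\<alpha> \<in> E" "\<beta> \<in> E" "\<alpha> \<noteq> \<beta>" "d \<in> H" "d \<alpha> = \<alpha>" "d \<beta> = \<beta>" "d \<noteq> id"
    and large: "\<And>x. x \<in> E - {\<alpha>, \<beta>} \<Longrightarrow> m < card (range (\<lambda>k. (d ^^ k) x))"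
    and "y \<in> E" "y \<noteq> \<alpha>"
  shows "m < card ((\<lambda>h. h y) ` {h \<in> H. h \<alpha> = \<alpha>})"
proof -
  obtain h where h: "h \<in> H" "h \<alpha> = \<alpha>" "h y \<in> E - {\<alpha>, \<beta>}"
  proof (cases "y = \<beta>")
    case True
    obtain h where "h \<in> H" "h \<alpha> = \<alpha>" "h \<beta> \<noteq> \<beta>"
      using stabilizer_moves[OF assms(1-5,7)] .
    moreover from this have "h y \<noteq> \<alpha>" using assms inj_mem by metis
    ultimately show thesis using that True assms by auto
  next
    case False
    then show thesis using that[of id] id_mem assms by simp
  qed
  have "(d ^^ k) \<alpha> = \<alpha>" for k by (induction k) (simp_all add: assms)
  then have mem: "d ^^ k \<circ> h \<in> {h \<in> H. h \<alpha> = \<alpha>}" for k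
    using h by (simp add: comp_mem funpow_mem assms)
  have "range (\<lambda>k. (d ^^ k) (h y)) \<subseteq> (\<lambda>h. h y) ` {h \<in> H. h \<alpha> = \<alpha>}"
    by (rule image_subsetI, rule image_eqI[OF _ mem]) simp
  then have "card (range (\<lambda>k. (d ^^ k) (h y))) \<le> card ((\<lambda>h. h y) ` {h \<in> H. h \<alpha> = \<alpha>})"
    using finite_group by (intro card_mono) auto
  then show ?thesis using large[OF h(3)] by simp
qed

text \<open>Two conjugates of a double transposition whose supports meet in the single point \<open>\<alpha>\<close> have a
  3-cycle as their commutator.\<close>

lemma ex_three_cycle:
  assumes t: "transpose p q \<circ> transpose r s \<in> H" "distinct [p, q, r, s]" "{p, q, r, s} \<subseteq> E"
    and d: "\<alpha> \<in> E" "\<beta> \<in> E" "\<alpha> \<noteq> \<beta>" "d \<in> H" "d \<alpha> = \<alpha>" "d \<beta> = \<beta>" "d \<noteq> id"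
    and large: "\<And>x. x \<in> E - {\<alpha>, \<beta>} \<Longrightarrow> 9 < card (range (\<lambda>k. (d ^^ k) x))"
  obtains a b c where "three_cycle a b c \<in> H" "a \<noteq> b" "b \<noteq> c" "a \<noteq> c"
proof -
  have conj_t: "transpose (g p) (g q) \<circ> transpose (g r) (g s) \<in> H" if "g \<in> H" for g
    using conj_mem[OF t(1) that] conj_comp[OF bij_mem[OF that]] conj_transpose[OF bij_mem[OF that]]
    by metis
  \<comment> \<open>Transitivity gives a conjugate of the double transposition that moves \<alpha>.
    Separation in the stabiliser of \<alpha> will then move its other three points, the set
    \<open>S\<close>, off themselves.\<close>
  obtain g where g: "g \<in> H" "g p = \<alpha>" using trans t(3) d(1) by blast
  define q' r' s' where "q' = g q" "r' = g r" "s' = g s"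
  define S where "S = {q', r', s'}"
  have dist: "distinct [\<alpha>, q', r', s']"
    using t(2) g inj_mem[OF g(1)] unfolding q'_r'_s'_def by auto
  have S: "S \<subseteq> E - {\<alpha>}"
    using dist t(3) g(1) unfolding S_def q'_r'_s'_def by auto
  interpret A: perm_group E "{h \<in> H. h \<alpha> = \<alpha>}"
    by (rule perm_group_stabilizer)
  have fin_S: "finite S" by (simp add: S_def)
  \<comment> \<open>The 9 in \<open>large\<close> is the product \<open>card S * card S\<close> for
    a set of three points.\<close>
  have "card S * card S < card ((\<lambda>h. h y) ` {h \<in> H. h \<alpha> = \<alpha>})" if "y \<in> S" for y
  proof -
    have "card S = 3" using dist by (simp add: S_def)
    moreover have "9 < card ((\<lambda>h. h y) ` {h \<in> H. h \<alpha> = \<alpha>})"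
      using that S by (intro stabilizer_orbit_large[OF d large]) auto
    ultimately show ?thesis by simp
  qed
  then obtain h where "h \<in> {h \<in> H. h \<alpha> = \<alpha>}" "h ` S \<inter> S = {}"
    by (rule A.separation[OF fin_S fin_S])
  then have h: "h \<in> H" "h \<alpha> = \<alpha>" "h ` S \<inter> S = {}" by auto
  define q'' r'' s'' where "q'' = h q'" "r'' = h r'" "s'' = h s'"
  have dist': "distinct [\<alpha>, q', r', s', q'', r'', s'']"
  proof -
    have "distinct [\<alpha>, q'', r'', s'']"
      using dist h(2) inj_mem[OF h(1)] unfolding q''_r''_s''_def by auto
    moreover have "{q'', r'', s''} \<inter> {q', r', s'} = {}"
      using h(3) by (simp add: S_def q''_r''_s''_def)
    ultimately show ?thesis using dist by auto
  qed
  then have dist'_rev: "distinct [s'', r'', q'', s', r', q', \<alpha>]"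
    by auto
  let ?t = "transpose \<alpha> q' \<circ> transpose r' s'" and ?t' = "transpose \<alpha> q'' \<circ> transpose r'' s''"
  have "?t \<in> H" "?t' \<in> H"
    using conj_t[OF g(1)] conj_t[OF comp_mem[OF h(1) g(1)]] g h
    unfolding q'_r'_s'_def q''_r''_s''_def by simp_all
  \<comment> \<open>Both factors are involutions, so the square of their product is their
    commutator.\<close>
  then have "(?t \<circ> ?t') \<circ> (?t \<circ> ?t') \<in> H" by (intro comp_mem[of "?t \<circ> ?t'"] comp_mem[of ?t])
  moreover have "(?t \<circ> ?t') \<circ> (?t \<circ> ?t') = three_cycle \<alpha> q' q''"
  proof
    fix x
    consider "x \<in> {\<alpha>, q', r', s', q'', r'', s''}" | "x \<notin> {\<alpha>, q', r', s', q'', r'', s''}"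
      by blast
    then show "((?t \<circ> ?t') \<circ> (?t \<circ> ?t')) x = three_cycle \<alpha> q' q'' x"
    proof cases
      case 1
      then show ?thesis
        by (elim insertE emptyE) (use dist' dist'_rev in simp_all)
    next
      case 2
      then show ?thesis by simp
    qed
  qed
  ultimately have "three_cycle \<alpha> q' q'' \<in> H" by simp
  then show thesis using that dist' by auto
qed

end

section \<open>Block systems\<close>

definition preserves :: "('a \<Rightarrow> 'a) \<Rightarrow> ('a \<times> 'a) set \<Rightarrow> bool"
  where "preserves g r \<longleftrightarrow> (\<forall>x y. (x, y) \<in> r \<longrightarrow> (g x, g y) \<in> r)"

lemma preserves_class_fixing:
  assumes "equiv E r" "\<And>x. x \<in> E \<Longrightarrow> (x, g x) \<in> r"
  shows "preserves g r"
  unfolding preserves_def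
proof (intro allI impI)
  fix x y assume xy: "(x, y) \<in> r"
  have "sym r" "trans r" "x \<in> E" "y \<in> E"
    using assms(1) xy by (auto simp: equiv_def)
  then show "(g x, g y) \<in> r"
    using assms(2)[of x] assms(2)[of y] xy by (meson symD transD)
qed

text \<open>The injective map that \<open>g\<close> induces on pairs sends the finite set
  \<open>r\<close> into itself, hence onto itself. Thus the one-sided condition
  \<open>preserves\<close> still cuts out a group.\<close>

lemma preserves_inv:
  assumes "finite r" "bij g" "preserves g r"
  shows "preserves (inv' g) r"
proof -
  have "inj_on (map_prod g g) r"
    using assms(2) by (auto simp: inj_on_def bij_def)
  moreover have "map_prod g g ` r \<subseteq> r"
    using assms(3) by (auto simp: preserves_def)
  ultimately have r: "map_prod g g ` r = r"
    by (intro endo_inj_surj assms(1))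
  show ?thesis
    unfolding preserves_def
  proof (intro allI impI)
    fix x y assume "(x, y) \<in> r"
    then have "(x, y) \<in> map_prod g g ` r" unfolding r .
    then obtain u v where "(u, v) \<in> r" "x = g u" "y = g v" by auto
    then show "(inv' g x, inv' g y) \<in> r"
      using assms(2) by (simp add: bij_is_inj inv_f_f)
  qed
qed

lemma (in perm_group) perm_group_block_stabilizer:
  assumes "equiv E r"
  shows "perm_group E {h \<in> H. preserves h r}"
proof -
  have "finite r"
    using assms fin by (auto simp: equiv_def intro: finite_subset[of r "E \<times> E"])
  then have "preserves (inv' h) r" if "h \<in> H" "preserves h r" for h
    using that preserves_inv bij_mem by blast
  then show ?thesis
    by unfold_locales (auto simp: fin perm id_mem comp_mem inv_mem preserves_def)
qed

text \<open>The last conclusion is the case split of the main argument: either a 3-cycle fits into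
  one class, or the classes are pairs.\<close>

lemma (in perm_group) ex_block_system:
  assumes "\<not> primitive_perm_group E H" "card E \<ge> 5"
  obtains r where "equiv E r" "\<And>h. h \<in> H \<Longrightarrow> preserves h r" "r \<noteq> E \<times> E" "r \<noteq> Id_on E"
    "(\<exists>x\<in>E. 3 \<le> card (r `` {x})) \<or> (\<forall>x\<in>E. card (r `` {x}) = 2)"
proof (cases "\<forall>x\<in>E. \<forall>y\<in>E. \<exists>h\<in>H. h x = y")
  case True
  then obtain r where r: "equiv E r" "\<And>h. h \<in> H \<Longrightarrow> preserves h r" "r \<noteq> E \<times> E" "r \<noteq> Id_on E"
    using assms(1) unfolding primitive_perm_group_def primitive_perm_group_axioms_def preserves_def
    by (metis perm_group_axioms)
  have cl: "finite (r `` {x})" "x \<in> E \<Longrightarrow> x \<in> r `` {x}" for x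
    using r(1) fin by (auto simp: equiv_def refl_on_def intro: finite_subset[of _ E])
  \<comment> \<open>Used in both directions, this makes all classes equally large.\<close>
  have le: "card (r `` {x}) \<le> card (r `` {y})" if "x \<in> E" "y \<in> E" for x y
  proof -
    obtain h where h: "h \<in> H" "h x = y" using True \<open>x \<in> E\<close> \<open>y \<in> E\<close> by blast
    then have "h ` (r `` {x}) \<subseteq> r `` {y}"
      using r(2)[OF h(1)] by (auto simp: preserves_def)
    moreover have "inj_on h (r `` {x})" using h by (simp add: inj_on_def inj_mem)
    ultimately show ?thesis using cl card_inj_on_le by blast
  qed
  have "Id_on E \<subseteq> r" using cl(2) by auto
  then obtain x y where "(x, y) \<in> r" "(x, y) \<notin> Id_on E" using r(4) by auto
  moreover have "x \<in> E" if "(x, y) \<in> r" for x y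
    using r(1) that by (auto simp: equiv_def)
  ultimately obtain x y where xy: "(x, y) \<in> r" "x \<noteq> y" "x \<in> E"
    by (metis Id_onI)
  then have "card {x, y} \<le> card (r `` {x})"
    using cl[of x] by (intro card_mono) auto
  then have "2 \<le> card (r `` {x})" using xy by simp
  then have "(\<exists>x\<in>E. 3 \<le> card (r `` {x})) \<or> (\<forall>x\<in>E. card (r `` {x}) = 2)"
  proof (cases "3 \<le> card (r `` {x})")
    case False
    then have "card (r `` {z}) = 2" if "z \<in> E" for z
      using le[OF xy(3) that] le[OF that xy(3)] \<open>2 \<le> card (r `` {x})\<close> by linarith
    then show ?thesis by blast
  qed (use xy(3) in blast)
  with r show thesis using that by blast
next
  case False
  then obtain x y where xy: "x \<in> E" "y \<in> E" "\<And>h. h \<in> H \<Longrightarrow> h x \<noteq> y" by blast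
  define D where "D = (\<lambda>h. h x) ` H"
  \<comment> \<open>The two classes are the orbit \<open>D\<close> and its complement; with at least
    five points, one of them has at least three.\<close>
  define r where "r = {(u, v). u \<in> E \<and> v \<in> E \<and> (u \<in> D \<longleftrightarrow> v \<in> D)}"
  have D: "x \<in> D" "y \<notin> D" "D \<subseteq> E"
  proof -
    have "id x \<in> D" unfolding D_def using id_mem by (rule imageI)
    then show "x \<in> D" by simp
  qed (use xy in \<open>auto simp: D_def\<close>)
  have D_iff: "h u \<in> D \<longleftrightarrow> u \<in> D" if "h \<in> H" for h u
  proof
    assume "h u \<in> D"
    then obtain g where "g \<in> H" "h u = g x" by (auto simp: D_def)
    then have "inv' h \<circ> g \<in> H" "u = (inv' h \<circ> g) x"
      using that by (auto simp: comp_mem inv_mem) (metis inv_apply(1))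
    then show "u \<in> D" unfolding D_def by blast
  next
    assume "u \<in> D"
    then obtain g where "g \<in> H" "u = g x" by (auto simp: D_def)
    then have "h \<circ> g \<in> H" "h u = (h \<circ> g) x" using that by (auto simp: comp_mem)
    then show "h u \<in> D" unfolding D_def by blast
  qed
  have eq: "equiv E r"
    by (rule equivI) (auto simp: r_def refl_on_def sym_def trans_def)
  have cls: "r `` {x} = D" "r `` {y} = E - D"
    using D xy by (auto simp: r_def)
  have "card D + card (E - D) = card E"
    using D fin by (metis card_Diff_subset card_mono finite_subset le_add_diff_inverse)
  then have "3 \<le> card D \<or> 3 \<le> card (E - D)"
    using assms(2) by linarith
  then have large: "\<exists>x\<in>E. 3 \<le> card (r `` {x})"
    using cls xy(1,2) by metis
  have "r \<noteq> Id_on E"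
  proof
    assume "r = Id_on E"
    then have le1: "card (r `` {z}) \<le> 1" for z
      using card_mono[of "{z}" "r `` {z}"] by auto
    obtain z where "3 \<le> card (r `` {z})" using large by blast
    with le1[of z] show False by simp
  qed
  moreover have "(x, y) \<notin> r" using D by (simp add: r_def)
  then have "r \<noteq> E \<times> E" using xy(1,2) by blast
  moreover have "preserves h r" if "h \<in> H" for h
    using that D_iff by (simp add: preserves_def r_def)
  ultimately show thesis using that eq large by blast
qed

text \<open>One point is chosen from each pair other than {\<alpha>, \<beta>}, the chosen points are
  permuted in a single cycle, and their partners are permuted in parallel. The linear order serves
  to make the choice.\<close>

lemma ex_even_pairing_perm:
  fixes E :: "'a :: linorder set"
  assumes E: "finite E" and r: "equiv E r" "\<And>x. x \<in> E \<Longrightarrow> card (r `` {x}) = 2"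
    and ab: "(\<alpha>, \<beta>) \<in> r" "\<alpha> \<noteq> \<beta>" and m: "2 * m + 3 < card E"
  obtains d where "d permutes E" "evenperm d" "preserves d r" "d \<alpha> = \<alpha>" "d \<beta> = \<beta>"
    "\<And>x. x \<in> E - {\<alpha>, \<beta>} \<Longrightarrow> m < card (range (\<lambda>k. (d ^^ k) x))"
proof -
  have rE: "r \<subseteq> E \<times> E" and refl: "\<And>x. x \<in> E \<Longrightarrow> (x, x) \<in> r" and sym: "sym r"
    using r(1) by (auto simp: equiv_def refl_on_def)
  have "\<exists>y. (x, y) \<in> r \<and> y \<noteq> x \<and> r `` {x} = {x, y}" if x: "x \<in> E" for x
  proof -
    obtain u v where uv: "r `` {x} = {u, v}" "u \<noteq> v"
      using r(2)[OF x] by (auto simp: card_2_iff)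
    moreover have "x \<in> {u, v}" using refl[OF x] uv by auto
    ultimately show ?thesis by fastforce
  qed
  then obtain mate0 where mate0:
    "\<And>x. x \<in> E \<Longrightarrow> (x, mate0 x) \<in> r \<and> mate0 x \<noteq> x \<and> r `` {x} = {x, mate0 x}" by metis
  \<comment> \<open>Fixing all points outside \<open>E\<close> makes \<open>mate\<close> an
    involution of the whole type and a permutation of \<open>E\<close>.\<close>
  define mate where "mate x = (if x \<in> E then mate0 x else x)" for x
  have mate: "(x, mate x) \<in> r" "mate x \<noteq> x" "mate x \<in> E" if "x \<in> E" for x
    using mate0[OF that] that rE by (auto simp: mate_def)
  have mateI: "y = mate x" if "(x, y) \<in> r" "y \<noteq> x" for x y
    using mate0[of x] that rE by (auto simp: mate_def)
  have mate_out: "x \<notin> E \<Longrightarrow> mate x = x" for x by (simp add: mate_def)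
  have mate2 [simp]: "mate (mate x) = x" for x
  proof (cases "x \<in> E")
    case True
    then show ?thesis
      using mate[OF True] mateI[of "mate x" x] symD[OF sym] by metis
  qed (simp add: mate_out)
  have mate_in [simp]: "mate x \<in> E \<longleftrightarrow> x \<in> E" for x
    using mate(3) mate_out by metis
  have inj_mate: "mate x = mate y \<longleftrightarrow> x = y" for x y by (metis mate2)
  have perm_mate: "mate permutes E"
    by (rule bij_imp_permutes) (auto simp: mate_out intro!: bij_betwI[where g = mate])
  have beta: "\<beta> = mate \<alpha>" and alphaE: "\<alpha> \<in> E" "\<beta> \<in> E"
    using mateI ab rE by auto
  \<comment> \<open>The smaller point of every other pair, so that \<open>X\<close> and its image
    under \<open>mate\<close> partition \<open>E - {\<alpha>, \<beta>}\<close>.\<close>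
  define X where "X = {x \<in> E - {\<alpha>, \<beta>}. x < mate x}"
  have X_mate: "x \<in> X \<Longrightarrow> mate x \<notin> X" for x by (auto simp: X_def)
  have X_or: "x \<in> X \<or> mate x \<in> X" if "x \<in> E - {\<alpha>, \<beta>}" for x
  proof -
    have "mate x \<in> E - {\<alpha>, \<beta>}"
      using that beta by (auto simp: inj_mate)
    then show ?thesis
      using that mate(2)[of x] by (auto simp: X_def)
  qed
  have XE: "X \<subseteq> E" "finite X" "\<alpha> \<notin> X" "\<beta> \<notin> X" "mate \<alpha> \<notin> X" "mate \<beta> \<notin> X"
    using E beta by (auto simp: X_def)
  have cardX: "m < card X"
  proof -
    have "E \<subseteq> {\<alpha>, \<beta>} \<union> (X \<union> mate ` X)"
    proof
      fix x assume "x \<in> E"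
      then show "x \<in> {\<alpha>, \<beta>} \<union> (X \<union> mate ` X)"
        using X_or[of x] by (auto simp: image_iff) (metis mate2)
    qed
    then have "card E \<le> card ({\<alpha>, \<beta>} \<union> (X \<union> mate ` X))"
      using XE by (intro card_mono) auto
    also have "\<dots> \<le> card {\<alpha>, \<beta>} + (card X + card (mate ` X))"
      using card_Un_le[of "{\<alpha>, \<beta>}" "X \<union> mate ` X"] card_Un_le[of X "mate ` X"] by linarith
    also have "\<dots> \<le> 2 + (card X + card X)"
      using card_image_le[OF XE(2), of mate] ab(2) by simp
    finally show ?thesis using m by simp
  qed
  define xs where "xs = sorted_list_of_set X"
  have xs: "distinct xs" "set xs = X" using XE by (simp_all add: xs_def)
  define \<sigma> where "\<sigma> = cycle_of_list xs"
  have \<sigma>_perm: "\<sigma> permutes X" using cycle_permutes[of xs] xs by (simp add: \<sigma>_def)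
  have \<sigma>_in: "\<sigma> x \<in> X \<longleftrightarrow> x \<in> X" for x using permutes_in_image[OF \<sigma>_perm] .
  have \<sigma>_out: "x \<notin> X \<Longrightarrow> \<sigma> x = x" for x using permutes_not_in[OF \<sigma>_perm] .
  have \<sigma>_trans: "\<exists>k. (\<sigma> ^^ k) x = y" if "x \<in> X" "y \<in> X" for x y
  proof -
    obtain i j where ij: "i < length xs" "xs ! i = x" "j < length xs" "xs ! j = y"
      using \<open>x \<in> X\<close> \<open>y \<in> X\<close> xs(2) by (metis in_set_conv_nth)
    \<comment> \<open>Rotation by \<open>k\<close> reads position
      \<open>i + k = length xs + j\<close>, which is \<open>j\<close> modulo the length.\<close>
    define k where "k = length xs - i + j"
    have "(\<sigma> ^^ k) x = map (\<sigma> ^^ k) xs ! i" using ij by simp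
    also have "\<dots> = rotate k xs ! i" using cyclic_rotation[OF xs(1)] by (simp add: \<sigma>_def)
    also have "\<dots> = y" using ij by (simp add: nth_rotate k_def)
    finally show ?thesis by blast
  qed
  \<comment> \<open>Since \<open>mate\<close> is its own inverse, the second factor is the conjugate
    of \<sigma> acting on the partners of \<open>X\<close>.\<close>
  define d where "d = \<sigma> \<circ> (mate \<circ> \<sigma> \<circ> mate)"
  have d_X: "d x = \<sigma> x" if "x \<in> X" for x
    using X_mate[OF that] by (simp add: d_def \<sigma>_out)
  have d_mate_X: "d x = mate (\<sigma> (mate x))" if "mate x \<in> X" for x
    using that X_mate[of "\<sigma> (mate x)"] \<sigma>_in by (simp add: d_def \<sigma>_out)
  have d_other: "d x = x" if "x \<notin> X" "mate x \<notin> X" for x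
    using that by (simp add: d_def \<sigma>_out)
  have d_mate: "d (mate x) = mate (d x)" for x
  proof -
    consider "x \<in> X" | "mate x \<in> X" | "x \<notin> X" "mate x \<notin> X" by blast
    then show ?thesis
      by cases (simp_all add: d_X d_mate_X d_other)
  qed
  have "\<sigma> permutes E" using permutes_subset[OF \<sigma>_perm XE(1)] .
  then have d_perm: "d permutes E"
    unfolding d_def by (intro permutes_compose perm_mate)
  \<comment> \<open>Both \<sigma> and \<open>mate\<close> occur twice in \<open>d\<close>, so their
    parities cancel.\<close>
  have d_even: "evenperm d"
  proof -
    have "permutation \<sigma>" "permutation mate"
      using \<open>\<sigma> permutes E\<close> perm_mate E permutation_permutes by blast+
    then show ?thesis
      unfolding d_def by (auto simp: evenperm_comp permutation_compose)
  qed
  have "preserves d r"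
    unfolding preserves_def
  proof (intro allI impI)
    fix x y assume xy: "(x, y) \<in> r"
    then have dx: "d x \<in> E" using rE permutes_in_image[OF d_perm] by blast
    show "(d x, d y) \<in> r"
    proof (cases "y = x")
      case True
      then show ?thesis using refl[OF dx] by simp
    next
      case False
      then show ?thesis using mateI[OF xy False] d_mate mate(1)[OF dx] by simp
    qed
  qed
  moreover have "d \<alpha> = \<alpha>" "d \<beta> = \<beta>" using XE d_other by simp_all
  moreover have "m < card (range (\<lambda>k. (d ^^ k) x))" if x: "x \<in> E - {\<alpha>, \<beta>}" for x
  proof -
    have fin_range: "finite (range (\<lambda>k. (d ^^ k) y))" if "y \<in> E" for y
    proof (rule finite_subset[OF _ E])
      show "range (\<lambda>k. (d ^^ k) y) \<subseteq> E"
        using that permutes_in_image[OF permutes_funpow[OF d_perm]] by blast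
    qed
    have X_orbit: "m < card (range (\<lambda>k. (d ^^ k) y))" if y: "y \<in> X" for y
    proof -
      have "(d ^^ k) y = (\<sigma> ^^ k) y \<and> (\<sigma> ^^ k) y \<in> X" for k
        by (induction k) (simp_all add: y d_X \<sigma>_in)
      then have "X \<subseteq> range (\<lambda>k. (d ^^ k) y)"
        using \<sigma>_trans[OF y] by (metis (no_types, lifting) rangeI subsetI)
      then have "card X \<le> card (range (\<lambda>k. (d ^^ k) y))"
        using fin_range[of y] y XE by (intro card_mono) auto
      then show ?thesis using cardX by simp
    qed
    show ?thesis
    proof (cases "x \<in> X")
      case False
      \<comment> \<open>As \<open>d\<close> commutes with \<open>mate\<close>, the orbit of a
        partner is the \<open>mate\<close>-image of an orbit; this reduces the claim to points of
        \<open>X\<close>.\<close>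
      have "(d ^^ k) (mate x) = mate ((d ^^ k) x)" for k
        by (induction k) (simp_all add: d_mate)
      then have "range (\<lambda>k. (d ^^ k) (mate x)) = mate ` range (\<lambda>k. (d ^^ k) x)"
        by (simp add: image_image)
      then have "card (range (\<lambda>k. (d ^^ k) (mate x))) \<le> card (range (\<lambda>k. (d ^^ k) x))"
        using card_image_le[OF fin_range[of x], of mate] x by simp
      then show ?thesis using X_orbit[of "mate x"] X_or[OF x] False by simp
    qed (rule X_orbit)
  qed
  ultimately show thesis using that d_perm d_even by blast
qed

section \<open>Translation from subgroups of the symmetric group\<close>

lemma subgroup_sym_group_iff: "subgroup H (sym_group n) \<longleftrightarrow> perm_group {1..n} H"
proof
  assume H: "subgroup H (sym_group n)"
  have mem: "h \<in> carrier (sym_group n)" if "h \<in> H" for h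
    using subgroup.mem_carrier[OF H that] .
  show "perm_group {1..n} H"
  proof
    fix g h assume g: "g \<in> H" and h: "h \<in> H"
    show "h permutes {1..n}" using mem[OF h] by (simp add: sym_group_carrier)
    show "g \<circ> h \<in> H" using subgroup.m_closed[OF H g h] by (simp add: sym_group_mult)
    show "inv' h \<in> H" using subgroup.m_inv_closed[OF H h] sym_group_inv_equality[OF mem[OF h]] by simp
  qed (use subgroup.one_closed[OF H] in \<open>simp_all add: sym_group_one\<close>)
next
  assume "perm_group {1..n} H"
  then interpret perm_group "{1..n}" H .
  interpret G: group "sym_group n" by (rule sym_group_is_group)
  show "subgroup H (sym_group n)"
  proof (rule G.subgroupI)
    show "H \<subseteq> carrier (sym_group n)" using perm by (auto simp: sym_group_carrier)
    then show "inv\<^bsub>sym_group n\<^esub> h \<in> H" if "h \<in> H" for h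
      using sym_group_inv_equality[of h n] inv_mem[OF that] that by auto
  qed (use id_mem comp_mem in \<open>auto simp: sym_group_mult\<close>)
qed

text \<open>Invariant partitions and invariant equivalence relations correspond through the
  quotient; the one-block partition matches \<open>?E \<times> ?E\<close> and the partition into
  singletons matches \<open>Id_on ?E\<close>.\<close>

lemma primitive_on_iff:
  assumes "subgroup H (sym_group n)"
  shows "primitive_on n H \<longleftrightarrow> primitive_perm_group {1..n} H"
proof
  let ?E = "{1..n}"
  interpret perm_group ?E H using assms subgroup_sym_group_iff by blast
  have app: "perm_action ?E h x = h x" if "x \<in> ?E" for h x
    using that by (simp add: perm_action_def)
  {
    assume "primitive_on n H"
    then interpret P: primitive_action "(sym_group n)\<lparr>carrier := H\<rparr>" ?E "perm_action ?E"
      by (simp add: primitive_on_def)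
    show "primitive_perm_group ?E H"
    proof
      fix x y assume "x \<in> ?E" "y \<in> ?E"
      then show "\<exists>h\<in>H. h x = y" using P.unique_orbit[of x y] app by auto
    next
      fix r assume r: "equiv ?E r" and inv: "\<And>h x y. h \<in> H \<Longrightarrow> (x, y) \<in> r \<Longrightarrow> (h x, h y) \<in> r"
      have rE: "r \<subseteq> ?E \<times> ?E" and refl: "x \<in> ?E \<Longrightarrow> x \<in> r `` {x}" for x
        using r by (auto simp: equiv_def refl_on_def)
      have img: "h ` (r `` {x}) = r `` {h x}" if h: "h \<in> H" for h x
      proof (intro equalityI subsetI)
        fix y assume "y \<in> r `` {h x}"
        then have "inv' h y \<in> r `` {x}" using inv[OF inv_mem[OF h], of "h x" y] h by simp
        then show "y \<in> h ` (r `` {x})" using image_eqI[of y h "inv' h y"] h by simp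
      qed (use inv[OF h] in auto)
      have "perm_action ?E h ` B \<in> ?E // r" if h: "h \<in> H" and B: "B \<in> ?E // r" for h B
      proof -
        obtain x where x: "x \<in> ?E" "B = r `` {x}" using B by (auto simp: quotient_def)
        have "perm_action ?E h ` B = h ` B"
          using x rE app by (intro image_cong) auto
        then show ?thesis
          using x img[OF h] h by (metis in_E_iff quotientI)
      qed
      then have "?E // r = {?E} \<or> ?E // r = (\<lambda>x. {x}) ` ?E"
        using P.trivial_partition[OF partition_on_quotient[OF r]] by simp
      then show "r = ?E \<times> ?E \<or> r = Id_on ?E"
      proof
        assume q: "?E // r = {?E}"
        have "r `` {x} = ?E" if "x \<in> ?E" for x using quotientI[OF that, of r] q by simp
        then show ?thesis using rE by blast
      next
        assume q: "?E // r = (\<lambda>x. {x}) ` ?E"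
        have single: "r `` {x} = {x}" if x: "x \<in> ?E" for x
        proof -
          obtain y where "r `` {x} = {y}" using quotientI[OF x, of r] q by auto
          then show ?thesis using refl[OF x] by simp
        qed
        have "r = Id_on ?E"
        proof (intro equalityI subrelI)
          fix x y assume xy: "(x, y) \<in> r"
          then have x: "x \<in> ?E" using rE by blast
          have "y \<in> r `` {x}" using xy by simp
          then show "(x, y) \<in> Id_on ?E" using single[OF x] Id_onI[OF x] by simp
        next
          fix x y assume "(x, y) \<in> Id_on ?E"
          then show "(x, y) \<in> r" using refl by (auto simp del: atLeastAtMost_iff)
        qed
        then show ?thesis ..
      qed
    qed
  }
  assume "primitive_perm_group ?E H"
  then interpret P: primitive_perm_group ?E H .
  interpret A: group_action "(sym_group n)\<lparr>carrier := H\<rparr>" ?E "perm_action ?E"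
    by (rule perm_action_group_action[OF assms])
  show "primitive_on n H"
    unfolding primitive_on_def
  proof
    fix x y assume "x \<in> ?E" "y \<in> ?E"
    then show "\<exists>g\<in>carrier ((sym_group n)\<lparr>carrier := H\<rparr>). perm_action ?E g x = y"
      using P.trans app by simp
  next
    fix P assume P: "partition_on ?E P"
      and inv: "\<And>g B. g \<in> carrier ((sym_group n)\<lparr>carrier := H\<rparr>) \<Longrightarrow> B \<in> P \<Longrightarrow> perm_action ?E g ` B \<in> P"
    define r where "r = {(x, y). \<exists>B\<in>P. x \<in> B \<and> y \<in> B}"
    have r: "equiv ?E r" "?E // r = P"
      unfolding r_def using equiv_partition_on[OF P] partition_on_eq_quotient[OF P] by auto
    have "(h x, h y) \<in> r" if h: "h \<in> H" and "(x, y) \<in> r" for h x y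
    proof -
      obtain B where B: "B \<in> P" "x \<in> B" "y \<in> B" using \<open>(x, y) \<in> r\<close> by (auto simp: r_def)
      then have "x \<in> ?E" "y \<in> ?E" using P by (auto simp: partition_on_def)
      then have "h x \<in> perm_action ?E h ` B" "h y \<in> perm_action ?E h ` B"
        using B app by (metis image_eqI)+
      moreover have "perm_action ?E h ` B \<in> P" using inv[of h B] B h by simp
      ultimately show ?thesis by (auto simp: r_def)
    qed
    then consider "r = ?E \<times> ?E" | "r = Id_on ?E" using P.primitive[OF r(1)] by blast
    then show "P = {?E} \<or> P = (\<lambda>x. {x}) ` ?E"
    proof cases
      case 1
      show ?thesis
      \<comment> \<open>On the empty set the quotient is empty, which is the partition into
        singletons and not \<open>{?E}\<close>.\<close>
      proof (cases "?E = {}")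
        case True
        then show ?thesis using r(2) by (simp add: quotient_def)
      next
        case False
        then have "?E // (?E \<times> ?E) = {?E}" unfolding quotient_def by blast
        then show ?thesis using r(2) 1 by simp
      qed
    next
      case 2
      then have "r `` {x} = {x}" if "x \<in> ?E" for x using that by auto
      then have "?E // r = (\<lambda>x. {x}) ` ?E" unfolding quotient_def by auto
      then show ?thesis using r(2) by simp
    qed
  qed
qed

text \<open>The 3-cycles generate the alternating group. As generation takes place inside
  \<open>alt_group n\<close>, the subgroup considered is the intersection of \<open>H\<close> with
  it.\<close>

lemma alt_group_subset_if_three_cycles:
  assumes "perm_group {1..n} H"
    and "\<And>a b c. a \<in> {1..n} \<Longrightarrow> b \<in> {1..n} \<Longrightarrow> c \<in> {1..n} \<Longrightarrow> a \<noteq> b \<Longrightarrow> b \<noteq> c \<Longrightarrow> a \<noteq> c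
      \<Longrightarrow> three_cycle a b c \<in> H"
  shows "carrier (alt_group n) \<subseteq> H"
proof -
  let ?A = "carrier (alt_group n)"
  interpret S: group "sym_group n" by (rule sym_group_is_group)
  interpret A: group "alt_group n" by (rule alt_group_is_group)
  have H: "subgroup H (sym_group n)" using assms(1) subgroup_sym_group_iff by blast
  have eq: "(sym_group n)\<lparr>carrier := ?A\<rparr> = alt_group n"
    by (simp add: alt_group_def)
  have "subgroup (H \<inter> ?A) (sym_group n)"
    using S.subgroups_Inter_pair[OF H alt_group_is_subgroup] .
  then have sub: "subgroup (H \<inter> ?A) (alt_group n)"
    using S.subgroup_incl[OF _ alt_group_is_subgroup, of "H \<inter> ?A"] eq by simp
  have "three_cycles n \<subseteq> H \<inter> ?A"
  proof
    fix p assume p: "p \<in> three_cycles n"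
    then obtain cs where cs: "p = cycle_of_list cs" "distinct cs" "length cs = 3" "set cs \<subseteq> {1..n}"
      by auto
    then obtain a b c where "cs = [a, b, c]" by (auto simp: numeral_3_eq_3 length_Suc_conv)
    \<comment> \<open>On a list of three entries \<open>cycle_of_list\<close> unfolds to the two
      transpositions of \<open>three_cycle\<close>.\<close>
    then have "p \<in> H" using cs assms(2)[of a b c] by (simp add: three_cycle_def)
    then show "p \<in> H \<inter> ?A" using p three_cycles_incl by blast
  qed
  then have "generate (alt_group n) (three_cycles n) \<subseteq> H \<inter> ?A"
    using A.generate_subgroup_incl[OF _ sub] by simp
  then show ?thesis using alt_group_carrier_as_three_cycles by auto
qed

section \<open>Producing 3-cycles in the primitive group\<close>

text \<open>Here \<open>C\<close> plays the role of \<open>G\<close>, \<open>max\<close> is the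
  maximality of \<open>K\<close> in it, and \<open>cover\<close> is the fixer property. Assuming
  only that \<open>C\<close> contains the even permutations treats the alternating and the symmetric
  group together.\<close>

lemma three_cycle_mem_if_covers_nonprimitive_maximal:
  fixes E :: "'a :: linorder set"
  assumes C: "perm_group E C" and even: "\<And>p. p permutes E \<Longrightarrow> evenperm p \<Longrightarrow> p \<in> C"
    and K: "perm_group E K" "K \<subseteq> C" "\<not> primitive_perm_group E K"
    and max: "\<And>L. perm_group E L \<Longrightarrow> K \<subseteq> L \<Longrightarrow> L \<subseteq> C \<Longrightarrow> L = K \<or> L = C"
    and H: "primitive_perm_group E H"
    and cover: "\<And>k. k \<in> K \<Longrightarrow> \<exists>g\<in>C. inv' g \<circ> k \<circ> g \<in> H"
    and card: "25 \<le> card E"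
    and xyz: "x \<in> E" "y \<in> E" "z \<in> E" "x \<noteq> y" "y \<noteq> z" "x \<noteq> z"
  shows "three_cycle x y z \<in> H"
proof -
  interpret C: perm_group E C by (rule C)
  interpret H: primitive_perm_group E H by (rule H)
  have "5 \<le> card E" using card by simp
  then obtain r where r: "equiv E r" "\<And>k. k \<in> K \<Longrightarrow> preserves k r" "r \<noteq> E \<times> E" "r \<noteq> Id_on E"
    and classes: "(\<exists>x\<in>E. 3 \<le> card (r `` {x})) \<or> (\<forall>x\<in>E. card (r `` {x}) = 2)"
    using perm_group.ex_block_system[OF K(1,3)] by metis
  have rE: "r \<subseteq> E \<times> E" and refl: "\<And>x. x \<in> E \<Longrightarrow> (x, x) \<in> r" and sym: "sym r" and trans: "trans r"
    using r(1) by (auto simp: equiv_def refl_on_def)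
  have even_cycle: "three_cycle a b c \<in> C"
    if "a \<in> E" "b \<in> E" "c \<in> E" "a \<noteq> b" "b \<noteq> c" for a b c
    using that even[OF three_cycle_permutes] evenperm_transpose_comp[of a b b c]
    by (simp add: three_cycle_def)
  \<comment> \<open>For related \<open>a\<close>, \<open>b\<close> and an unrelated
    \<open>c\<close>, the cycle (a b c) sends the pair (a, b) to the unrelated pair (b, c). Hence
    the stabiliser of \<open>r\<close> in \<open>C\<close> is proper, and by maximality it is
    \<open>K\<close>.\<close>
  have "\<exists>p\<in>C. \<not> preserves p r"
  proof -
    obtain a b where ab: "(a, b) \<in> r" "a \<noteq> b"
    proof -
      have "Id_on E \<subseteq> r" using refl by auto
      then obtain a b where "(a, b) \<in> r" "(a, b) \<notin> Id_on E" using r(4) by auto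
      then show thesis using that rE by (metis Id_onI SigmaD1 subsetD)
    qed
    have abE: "a \<in> E" "b \<in> E" using ab rE by auto
    obtain c where c: "c \<in> E" "(a, c) \<notin> r"
    proof -
      obtain u v where "u \<in> E" "v \<in> E" "(u, v) \<notin> r" using r(3) rE by auto
      then show thesis using that sym trans by (meson symD transD)
    qed
    have ne: "b \<noteq> c" "a \<noteq> c" using ab c refl by auto
    have "(b, c) \<notin> r" using transD[OF trans ab(1)] c(2) by blast
    then have "(three_cycle a b c a, three_cycle a b c b) \<notin> r" using ab ne by simp
    then have "\<not> preserves (three_cycle a b c) r"
      using ab(1) unfolding preserves_def by blast
    then show ?thesis using even_cycle[OF abE c(1) ab(2) ne(1)] by blast
  qed
  moreover have "{p \<in> C. preserves p r} = K \<or> {p \<in> C. preserves p r} = C"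
    using K(2) r(2) by (intro max C.perm_group_block_stabilizer r(1)) auto
  ultimately have mem_K: "p \<in> K" if "p \<in> C" "preserves p r" for p
    using that by blast
  \<comment> \<open>The conjugation in \<open>cover\<close> is turned around by replacing
    \<open>g\<close> with its inverse, to fit \<open>conj_three_cycle\<close> and
    \<open>conj_transpose\<close>.\<close>
  have conj_H: "\<exists>g. bij g \<and> (\<forall>x. g x \<in> E \<longleftrightarrow> x \<in> E) \<and> g \<circ> k \<circ> inv' g \<in> H" if "k \<in> K" for k
  proof -
    obtain g where g: "g \<in> C" "inv' g \<circ> k \<circ> g \<in> H" using cover[OF \<open>k \<in> K\<close>] by blast
    have "inv' (inv' g) = g" using C.bij_mem[OF g(1)] by (rule inv_inv_eq)
    then show ?thesis
      using g C.inv_mem[OF g(1)] C.bij_mem C.in_E_iff by metis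
  qed
  have "\<exists>a b c. three_cycle a b c \<in> H \<and> a \<noteq> b \<and> b \<noteq> c \<and> a \<noteq> c"
    using classes
  proof
    assume "\<exists>x\<in>E. 3 \<le> card (r `` {x})"
    then obtain u A where A: "A \<subseteq> r `` {u}" "card A = 3" by (meson obtain_subset_with_card_n)
    then obtain a b c where abc: "A = {a, b, c}" "a \<noteq> b" "b \<noteq> c" "a \<noteq> c"
      by (auto simp: card_3_iff)
    then have u: "(u, a) \<in> r" "(u, b) \<in> r" "(u, c) \<in> r" using A(1) by auto
    have rel: "(a, b) \<in> r" "(b, c) \<in> r" "(c, a) \<in> r"
      using u sym trans by (meson symD transD)+
    have "preserves (three_cycle a b c) r"
    proof (rule preserves_class_fixing[OF r(1)])
      fix x assume "x \<in> E"
      then show "(x, three_cycle a b c x) \<in> r"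
        using rel abc refl
        by (cases "x \<in> {a, b, c}") auto
    qed
    moreover have "three_cycle a b c \<in> C"
      using even_cycle[of a b c] u rE abc by auto
    ultimately obtain g where g: "bij g" "g \<circ> three_cycle a b c \<circ> inv' g \<in> H"
      using conj_H mem_K by blast
    then have "three_cycle (g a) (g b) (g c) \<in> H" using conj_three_cycle[OF g(1)] by metis
    moreover have "g a \<noteq> g b" "g b \<noteq> g c" "g a \<noteq> g c"
      using abc g(1) by (auto simp: bij_def inj_eq)
    ultimately show ?thesis by blast
  next
    assume two: "\<forall>x\<in>E. card (r `` {x}) = 2"
    have mate: "\<exists>v. (u, v) \<in> r \<and> u \<noteq> v" if "u \<in> E" for u
    proof -
      obtain v w where "r `` {u} = {v, w}" "v \<noteq> w"
        using two \<open>u \<in> E\<close> unfolding card_2_iff by blast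
      then show ?thesis by blast
    qed
    obtain p q where pq: "(p, q) \<in> r" "p \<noteq> q" using mate[OF xyz(1)] by blast
    have "\<not> E \<subseteq> {p, q}" using card_mono[of "{p, q}" E] pq(2) card by auto
    then obtain s where s: "s \<in> E" "s \<noteq> p" "s \<noteq> q" by blast
    obtain t where t: "(s, t) \<in> r" "s \<noteq> t" using mate[OF s(1)] by blast
    have class_p: "r `` {p} = {p, q}"
    proof (rule card_seteq[symmetric])
      show "finite (r `` {p})" using rE C.fin by (auto intro: finite_subset[of _ E])
      show "{p, q} \<subseteq> r `` {p}" using pq refl rE by auto
      show "card (r `` {p}) \<le> card {p, q}" using two pq rE by auto
    qed
    have "(s, p) \<notin> r" using class_p s symD[OF sym, of s p] by auto
    then have "t \<noteq> p" "t \<noteq> q"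
      using t(1) transD[OF trans, of s q p] symD[OF sym pq(1)] by auto
    then have dist: "distinct [p, q, s, t]" using pq s t by auto
    have pqst: "p \<in> E" "q \<in> E" "s \<in> E" "t \<in> E" using pq t rE by auto
    \<comment> \<open>This even permutation swaps the points within each of two different pairs, so
      it preserves \<open>r\<close>.\<close>
    define \<tau> where "\<tau> = transpose p q \<circ> transpose s t"
    have "preserves \<tau> r"
    proof (rule preserves_class_fixing[OF r(1)])
      fix x assume "x \<in> E"
      then show "(x, \<tau> x) \<in> r"
        using dist pq(1) t(1) symD[OF sym pq(1)] symD[OF sym t(1)] refl
        by (auto simp: \<tau>_def transpose_def)
    qed
    moreover have "\<tau> permutes E"
      unfolding \<tau>_def using pqst by (intro permutes_compose permutes_swap_id)
    moreover have "evenperm \<tau>"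
      unfolding \<tau>_def using dist by (intro evenperm_transpose_comp) auto
    ultimately obtain g where g: "bij g" "\<And>x. g x \<in> E \<longleftrightarrow> x \<in> E" "g \<circ> \<tau> \<circ> inv' g \<in> H"
      using conj_H[of \<tau>] mem_K[of \<tau>] even by blast
    have "transpose (g p) (g q) \<circ> transpose (g s) (g t) \<in> H"
      using g(3) conj_comp[OF g(1)] conj_transpose[OF g(1)] unfolding \<tau>_def by metis
    moreover have "distinct [g p, g q, g s, g t]"
      using dist g(1) by (auto simp: bij_def inj_eq)
    moreover have "{g p, g q, g s, g t} \<subseteq> E" using pqst g(2) by simp
    \<comment> \<open>The orbit bound 9 is the one that \<open>ex_three_cycle\<close> asks for; the
      size of \<open>E\<close> allows it.\<close>
    moreover obtain d where d: "d permutes E" "evenperm d" "preserves d r" "d p = p" "d q = q"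
      "\<And>x. x \<in> E - {p, q} \<Longrightarrow> 9 < card (range (\<lambda>k. (d ^^ k) x))"
    proof (rule ex_even_pairing_perm[OF C.fin r(1) _ pq, of 9])
      show "2 * 9 + 3 < card E" using card by simp
    qed (use two in auto)
    obtain h where h: "bij h" "\<And>x. h x \<in> E \<longleftrightarrow> x \<in> E" "h \<circ> d \<circ> inv' h \<in> H"
      using conj_H[of d] mem_K[of d] even d(1-3) by blast
    have inv_h: "inv' h (h x) = x" "h (inv' h x) = x" for x
      using h(1) by (simp_all add: bij_is_inj inv_f_f bij_is_surj surj_f_inv_f)
    \<comment> \<open>The conjugate of \<open>d\<close> in \<open>H\<close> fixes \<open>h p\<close>
      and \<open>h q\<close>, and its orbits are the \<open>h\<close>-images of those of
      \<open>d\<close>, so the bound 9 carries over. The conjugators \<open>g\<close> and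
      \<open>h\<close> may differ.\<close>
    define d' where "d' = h \<circ> d \<circ> inv' h"
    have pow: "(d' ^^ k) x = h ((d ^^ k) (inv' h x))" for k x
      by (induction k) (simp_all add: d'_def inv_h)
    have large: "9 < card (range (\<lambda>k. (d' ^^ k) x))" if x: "x \<in> E - {h p, h q}" for x
    proof -
      have "inv' h x \<in> E - {p, q}" using x h(2)[of "inv' h x"] inv_h by auto
      then have "9 < card (range (\<lambda>k. (d ^^ k) (inv' h x)))" by (rule d(6))
      moreover have "card (h ` range (\<lambda>k. (d ^^ k) (inv' h x))) = card (range (\<lambda>k. (d ^^ k) (inv' h x)))"
        using h(1) by (intro card_image) (meson bij_is_inj inj_on_subset subset_UNIV)
      ultimately show ?thesis by (simp add: pow image_image)
    qed
    have "d' \<noteq> id"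
    proof
      assume "d' = id"
      have "h s \<in> E - {h p, h q}" using s h(1,2) by (auto simp: bij_def inj_eq)
      then show False using large[of "h s"] \<open>d' = id\<close> by simp
    qed
    moreover have "h p \<in> E" "h q \<in> E" "h p \<noteq> h q" "d' (h p) = h p" "d' (h q) = h q"
      using pqst pq(2) h(1,2) d(4,5) by (auto simp: bij_def inj_eq d'_def inv_h)
    moreover have "d' \<in> H" using h(3) by (simp add: d'_def)
    ultimately show ?thesis
      using H.ex_three_cycle[of "g p" "g q" "g s" "g t" "h p" "h q" d'] large by metis
  qed
  then show ?thesis using H.three_cycle_mem xyz by metis
qed

theorem lemma8p9:
  fixes n :: nat and G :: "(nat \<Rightarrow> nat) monoid" and H K :: "(nat \<Rightarrow> nat) set"
  assumes "n \<ge> 25"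
    and "G = alt_group n \<or> G = sym_group n"
    and "maximal_subgroup H G"
    and "core_free G H"
    and "primitive_on n H"
    and "maximal_subgroup K G"
    and "\<not> primitive_on n K"
  shows "\<not> fixer G (lcosets\<^bsub>G\<^esub> H) (coset_action G H) K"
proof
  assume fixer: "fixer G (lcosets\<^bsub>G\<^esub> H) (coset_action G H) K"
  interpret S: group "sym_group n" by (rule sym_group_is_group)
  let ?C = "carrier G"
  \<comment> \<open>Both alternatives for \<open>G\<close> become the symmetric group with carrier
    restricted to \<open>?C\<close>, so subgroups can be moved between the two.\<close>
  have C: "subgroup ?C (sym_group n)" and G: "G = (sym_group n)\<lparr>carrier := ?C\<rparr>"
    using assms(2) alt_group_is_subgroup S.subgroup_self by (auto simp: alt_group_def)
  have grp: "group G"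
    using assms(2) alt_group_is_group sym_group_is_group by blast
  have mult: "x \<otimes>\<^bsub>G\<^esub> y = x \<circ> y" for x y
    using assms(2) by (auto simp: alt_group_mult sym_group_mult)
  have inv: "inv\<^bsub>G\<^esub> g = inv' g" if "g \<in> ?C" for g
    using assms(2) that alt_group_inv_equality sym_group_inv_equality by blast
  have even: "p \<in> ?C" if "p permutes {1..n}" "evenperm p" for p
    using assms(2) that by (auto simp: alt_group_carrier sym_group_carrier)
  have to_sym: "subgroup L (sym_group n)" if "subgroup L G" for L
    using S.incl_subgroup[OF C] that G by metis
  have from_sym: "subgroup L G" if "subgroup L (sym_group n)" "L \<subseteq> ?C" for L
    using S.subgroup_incl[OF that(1) C that(2)] G by metis
  have HG: "subgroup H G" and KG: "subgroup K G"
    using assms(3,6) by (auto simp: maximal_subgroup_def)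
  have C_group: "perm_group {1..n} ?C" and H_prim: "primitive_perm_group {1..n} H"
    and K_group: "perm_group {1..n} K" and K_imprim: "\<not> primitive_perm_group {1..n} K"
    using C assms(5,7) primitive_on_iff[OF to_sym[OF HG]] primitive_on_iff[OF to_sym[OF KG]]
      to_sym[OF KG] by (simp_all add: subgroup_sym_group_iff)
  have max: "L = K \<or> L = ?C" if "perm_group {1..n} L" "K \<subseteq> L" "L \<subseteq> ?C" for L
    using that assms(6) from_sym[of L] unfolding maximal_subgroup_def subgroup_sym_group_iff by blast
  have cover: "\<exists>g\<in>?C. inv' g \<circ> k \<circ> g \<in> H" if "k \<in> K" for k
    using fixer that inv unfolding fixer_coset_action_iff[OF grp HG] mult by fastforce
  have card: "25 \<le> card {1..n}" using assms(1) by simp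
  have "carrier (alt_group n) \<subseteq> H"
  proof (rule alt_group_subset_if_three_cycles)
    show "perm_group {1..n} H" using H_prim by (simp add: primitive_perm_group_def)
  qed (use three_cycle_mem_if_covers_nonprimitive_maximal[OF C_group even K_group
        subgroup.subset[OF KG] K_imprim max H_prim cover card] in blast)
  \<comment> \<open>Conjugation by elements of \<open>G\<close> preserves even permutations, so
    every conjugate of \<open>H\<close> contains all of them, and so does the core.\<close>
  moreover have "{p. p permutes {1..n} \<and> evenperm p} \<subseteq> normal_core G H" if "carrier (alt_group n) \<subseteq> H"
  proof
    fix p assume p: "p \<in> {p. p permutes {1..n} \<and> evenperm p}"
    have "p \<in> g <#\<^bsub>G\<^esub> H #>\<^bsub>G\<^esub> inv\<^bsub>G\<^esub> g" if g: "g \<in> ?C" for g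
    proof -
      have gp: "g permutes {1..n}"
        using perm_group.perm[OF C_group g] .
      have "permutation g" "permutation p"
        using gp p permutation_permutes by (auto intro!: permutation_permutes[THEN iffD2])
      then have "inv' g \<circ> p \<circ> g \<in> carrier (alt_group n)"
        using gp p by (auto simp: alt_group_carrier evenperm_comp evenperm_inv permutation_compose
            permutation_inverse intro!: permutes_compose permutes_inv)
      then have "inv' g \<circ> p \<circ> g \<in> H" using \<open>carrier (alt_group n) \<subseteq> H\<close> by blast
      moreover have "p = g \<circ> (inv' g \<circ> p \<circ> g) \<circ> inv' g"
        using permutes_inverses[OF gp] by (simp add: fun_eq_iff)
      ultimately show ?thesis
        unfolding l_coset_def r_coset_def mult inv[OF g] by blast
    qed
    then show "p \<in> normal_core G H" by (simp add: normal_core_def)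
  qed
  moreover have "normal_core G H = {id}"
    using assms(2,4) by (auto simp: core_free_def alt_group_one sym_group_one)
  \<comment> \<open>A nontrivial even permutation, which contradicts the trivial core.\<close>
  moreover have "three_cycle 1 2 3 \<in> {p. p permutes {1..n} \<and> evenperm p}"
    using assms(1) three_cycle_permutes[of 1 "{1..n}" 2 3] evenperm_transpose_comp[of 1 2 2 "3 :: nat"]
    by (simp add: three_cycle_def)
  ultimately have "three_cycle 1 2 3 = (id :: nat \<Rightarrow> nat)" by blast
  then have "three_cycle 1 2 3 1 = (1 :: nat)" by simp
  then show False by simp
qed

end
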